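(* For $t=2$ pirates, under the averaging attack and minimum distance (MD) decoding, the fingerprinting capacity of the i.i.d. codebook ensemble $\mathcal{E}$ is $R_{\mathcal{E}}=\tfrac12$. That is: (1) for every rate $0<R<\tfrac12$, with $M=\lfloor 2^{nR}\rfloor$ users, the ensemble-average misidentification probability $P_m$ goes to zero exponentially fast as $n\to\infty$; (2) for every rate $R>\tfrac12$, with $M=\lfloor 2^{nR}\rfloor$ users, there is a constant $\delta>0$ such that $P_m>\delta$ for all sufficiently large $n$.
   Context: Codebook: there are $M$ users; user $u\in\{1,\dots,M\}$ is assigned a fingerprint $f(u)\in\{-1,+1\}^n$, where $n$ is the code length. i.i.d. codebook ensemble: the $M$ fingerprints are chosen independently, each uniformly from $\{-1,+1\}^n$ (equivalently uniformly from $\{0,1\}^n$ and then mapped to $\pm1$ coordinatewise). Averaging attack with $t=2$: a coalition $U=\{u_1,u_2\}$ of two distinct users, with fingerprints $\mathbf{x}_1,\mathbf{x}_2$, produces the forged copy $\mathbf{y}=\tfrac12(\mathbf{x}_1+\mathbf{x}_2)\in\{-1,0,1\}^n$ (real addition). MD decoder: the decoder knows the codebook and $\mathbf{y}$. Positions $i$ with $y_i=0$ are regarded as erased. The decoder finds the users whose fingerprint agrees with $\mathbf{y}$ in every unerased position and outputs such a user $g(\mathbf{y})$, chosen uniformly at random if there are several. Misidentification is the event $g(\mathbf{y})\notin U$. $P_m$ denotes the probability of misidentification averaged over the random codebook, over all $\binom{M}{2}$ coalitions $U$ (uniformly), and over the decoder's tie-breaking. Capacity of an ensemble $\mathcal{E}$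 under MD decoding: the number $R_{\mathcal{E}}$ such that for $M=2^{nR}$ with $R<R_{\mathcal{E}}$, $P_m\to0$ exponentially in $n$, and for $R>R_{\mathcal{E}}$ there is $\delta>0$ with $P_m>\delta$ for all sufficiently large $n$. *)

theory Defs
  imports "HOL-Probability.Probability" "HOL-Probability.Product_PMF"
begin

type_synonym fingerprint = "nat \<Rightarrow> real"
type_synonym codebook = "nat \<Rightarrow> fingerprint"

text \<open>
  Coordinates and users are numbered from 1. A fingerprint of length \<open>n\<close> is an extensional
  function on \<open>{1..n}\<close>, so that the set below is finite with \<open>2 ^ n\<close> elements.
\<close>

definition fingerprints :: "nat \<Rightarrow> fingerprint set" where
  "fingerprints n = {1..n} \<rightarrow>\<^sub>E {-1, 1}"

text \<open>
  An ensemble gives, for each code length \<open>n\<close> and number of users \<open>M\<close>, a distribution on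
  codebooks.
\<close>

type_synonym ensemble = "nat \<Rightarrow> nat \<Rightarrow> codebook pmf"

definition iid_ensemble :: ensemble where
  "iid_ensemble n M = Pi_pmf {1..M} undefined (\<lambda>_. pmf_of_set (fingerprints n))"

definition coalitions :: "nat \<Rightarrow> nat set set" where
  "coalitions M = {U. U \<subseteq> {1..M} \<and> card U = 2}"

definition averaging_attack :: "codebook \<Rightarrow> nat set \<Rightarrow> nat \<Rightarrow> real" where
  "averaging_attack f U = (\<lambda>i. (\<Sum>u\<in>U. f u i) / 2)"

definition md_candidates :: "nat \<Rightarrow> nat \<Rightarrow> codebook \<Rightarrow> (nat \<Rightarrow> real) \<Rightarrow> nat set" where
  "md_candidates n M f y = {u \<in> {1..M}. \<forall>i\<in>{1..n}. y i \<noteq> 0 \<longrightarrow> f u i = y i}"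

text \<open>
  The set of candidates is nonempty whenever \<open>y\<close> was forged by a coalition, whose members are
  candidates themselves.
\<close>

definition md_decoder :: "nat \<Rightarrow> nat \<Rightarrow> codebook \<Rightarrow> (nat \<Rightarrow> real) \<Rightarrow> nat pmf" where
  "md_decoder n M f y = pmf_of_set (md_candidates n M f y)"

text \<open>
  The value is meaningful only for \<open>M \<ge> 2\<close>, since otherwise there are no coalitions.
\<close>

definition misid_prob :: "ensemble \<Rightarrow> nat \<Rightarrow> nat \<Rightarrow> real" where
  "misid_prob E n M = measure_pmf.prob
     (do {
        f \<leftarrow> E n M;
        U \<leftarrow> pmf_of_set (coalitions M);
        g \<leftarrow> md_decoder n M f (averaging_attack f U);
        return_pmf (U, g)
      }) {(U, g). g \<notin> U}"

definition num_users :: "real \<Rightarrow> nat \<Rightarrow> nat" where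
  "num_users R n = nat \<lfloor>2 powr (real n * R)\<rfloor>"

text \<open>
  Rates are positive: for \<open>R \<le> 0\<close> there is at most one user. For \<open>R > 0\<close> the number of users
  is at least 2 for all large \<open>n\<close>, so the asymptotic conditions ignore the degenerate values of
  \<^const>\<open>misid_prob\<close>. The requirement \<open>0 \<le> C\<close> makes \<open>C\<close> unique.
\<close>

definition md_capacity :: "ensemble \<Rightarrow> real \<Rightarrow> bool" where
  "md_capacity E C \<longleftrightarrow> 0 \<le> C \<and>
     (\<forall>R. 0 < R \<and> R < C \<longrightarrow>
        (\<exists>c>0. \<forall>\<^sub>F n in sequentially. misid_prob E n (num_users R n) \<le> 2 powr (- c * real n))) \<and>
     (\<forall>R. C < R \<and> 0 < R \<longrightarrow>
        (\<exists>\<delta>>0. \<forall>\<^sub>F n in sequentially. \<delta> < misid_prob E n (num_users R n)))"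

end

theory Submission imports Defs "HOL-Real_Asymp.Real_Asymp" begin

text \<open>
  The set \<open>K\<close> of unerased positions is uniformly distributed among the subsets of \<open>{1..n}\<close>, and given
  \<open>K\<close>, each of the \<open>M - 2\<close> innocent users is independently a candidate with probability
  \<open>2\<^sup>-\<^sup>k\<close>, where \<open>k = card K\<close>. As \<open>k\<close> concentrates around \<open>n / 2\<close>, an innocent candidate exists
  with exponentially small probability if \<open>R < 1/2\<close>. The plain union bound averaged over \<open>K\<close> would
  only give \<open>R < log 2 (4/3)\<close>, because it is dominated by untypically small \<open>K\<close>. If \<open>R > 1/2\<close>, an
  innocent candidate is likely whenever \<open>k \<le> n / 2\<close>, which by symmetry happens with probability at
  least \<open>1/2\<close>.
\<close>

section \<open>Probabilities of sequentially composed experiments\<close>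

lemma measure_bind_pmf:
  "measure_pmf.prob (bind_pmf p f) X = measure_pmf.expectation p (\<lambda>x. measure_pmf.prob (f x) X)"
proof -
  have "ennreal (measure_pmf.prob (bind_pmf p f) X) = (\<integral>\<^sup>+x. ennreal (measure_pmf.prob (f x) X) \<partial>p)"
    by (simp flip: measure_pmf.emeasure_eq_measure)
  also have "\<dots> = ennreal (measure_pmf.expectation p (\<lambda>x. measure_pmf.prob (f x) X))"
    by (intro nn_integral_eq_integral measure_pmf.integrable_const_bound[where B=1]) auto
  finally show ?thesis
    by (simp add: integral_nonneg)
qed

lemma integrable_measure_pmf_prob [simp]:
  "integrable (measure_pmf p) (\<lambda>x. measure_pmf.prob (f x) X)"
  by (intro measure_pmf.integrable_const_bound[where B=1]) auto

lemma integrable_pmf_indicator [simp]: "integrable (measure_pmf p) (indicat_real A)"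
  by (intro measure_pmf.integrable_const_bound[where B=1]) auto

lemma measure_bind_pmf_const:
  assumes "\<And>x. x \<in> set_pmf p \<Longrightarrow> measure_pmf.prob (f x) X = c"
  shows "measure_pmf.prob (bind_pmf p f) X = c"
proof -
  have "measure_pmf.expectation p (\<lambda>x. measure_pmf.prob (f x) X) = measure_pmf.expectation p (\<lambda>_. c)"
    by (intro integral_cong_AE) (auto simp: AE_measure_pmf_iff assms)
  then show ?thesis
    by (simp add: measure_bind_pmf)
qed

text \<open>Applied at two levels: with \<open>A\<close> a codebook event that controls the
  decoder's error, and with \<open>A = UNIV\<close> to average a uniform bound over
  coalitions.\<close>

lemma measure_bind_pmf_le:
  assumes "\<And>x. x \<in> set_pmf p \<Longrightarrow> measure_pmf.prob (f x) X \<le> c * indicator A x"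
  shows "measure_pmf.prob (bind_pmf p f) X \<le> c * measure_pmf.prob p A"
proof -
  have "measure_pmf.expectation p (\<lambda>x. measure_pmf.prob (f x) X)
      \<le> measure_pmf.expectation p (\<lambda>x. c * indicator A x)"
    by (intro integral_mono_AE) (auto simp: AE_measure_pmf_iff assms)
  then show ?thesis
    by (simp add: measure_bind_pmf)
qed

lemma measure_bind_pmf_ge:
  assumes "\<And>x. x \<in> set_pmf p \<Longrightarrow> c * indicator A x \<le> measure_pmf.prob (f x) X"
  shows "c * measure_pmf.prob p A \<le> measure_pmf.prob (bind_pmf p f) X"
proof -
  have "measure_pmf.expectation p (\<lambda>x. c * indicator A x)
      \<le> measure_pmf.expectation p (\<lambda>x. measure_pmf.prob (f x) X)"
    by (intro integral_mono_AE) (auto simp: AE_measure_pmf_iff assms)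
  then show ?thesis
    by (simp add: measure_bind_pmf)
qed

section \<open>The set of unerased positions\<close>

definition agreement :: "nat \<Rightarrow> fingerprint \<Rightarrow> fingerprint \<Rightarrow> nat set" where
  "agreement n x z = {i \<in> {1..n}. x i = z i}"

lemma finite_fingerprints [simp]: "finite (fingerprints n)"
  by (auto simp: fingerprints_def intro!: finite_PiE)

lemma fingerprints_nonempty [simp]: "fingerprints n \<noteq> {}"
  by (auto simp: fingerprints_def PiE_eq_empty_iff)

lemma card_fingerprints: "card (fingerprints n) = 2 ^ n"
  by (simp add: fingerprints_def card_PiE numeral_2_eq_2)

lemma fingerprints_cases:
  assumes "x \<in> fingerprints n" "i \<in> {1..n}"
  obtains "x i = 1" | "x i = -1"
  using assms by (auto simp: fingerprints_def PiE_def Pi_def)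

text \<open>With two symbols, \<open>z\<close> is recovered from \<open>x\<close> and the agreement
  set by flipping the sign of \<open>x\<close> off that set. Hence, for each fixed \<open>x\<close>,
  a uniform \<open>z\<close> makes the agreement set a uniform subset.\<close>

lemma bij_betw_agreement:
  assumes x: "x \<in> fingerprints n"
  shows "bij_betw (agreement n x) (fingerprints n) (Pow {1..n})"
proof (rule bij_betw_byWitness[where f' = "\<lambda>K i. if i \<in> {1..n} then if i \<in> K then x i else - x i else undefined"])
  show "\<forall>z\<in>fingerprints n. (\<lambda>i. if i \<in> {1..n} then
      if i \<in> agreement n x z then x i else - x i else undefined) = z"
  proof (intro ballI ext)
    fix z i assume z: "z \<in> fingerprints n"
    show "(if i \<in> {1..n} then if i \<in> agreement n x z then x i else - x i else undefined) = z i"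
    proof (cases "i \<in> {1..n}")
      case True
      then show ?thesis
        by (cases rule: fingerprints_cases[OF x True]; cases rule: fingerprints_cases[OF z True])
           (auto simp: agreement_def)
    next
      case False
      then show ?thesis using z by (auto simp: fingerprints_def PiE_def extensional_def)
    qed
  qed
  have nz: "x i \<noteq> 0" if "i \<in> {1..n}" for i
    using fingerprints_cases[OF x that] by fastforce
  show "\<forall>K\<in>Pow {1..n}. agreement n x (\<lambda>i. if i \<in> {1..n} then if i \<in> K then x i else - x i else undefined) = K"
    using nz by (auto simp: agreement_def split: if_splits)
  show "agreement n x ` fingerprints n \<subseteq> Pow {1..n}"
    by (auto simp: agreement_def)
  show "(\<lambda>K i. if i \<in> {1..n} then if i \<in> K then x i else - x i else undefined) ` Pow {1..n}
      \<subseteq> fingerprints n"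
    using x by (force simp: fingerprints_def PiE_def Pi_def extensional_def)
qed

text \<open>The coordinates in \<open>K\<close> are forced and the other \<open>n - card K\<close>
  stay free.\<close>

lemma prob_agree_on:
  assumes x: "x \<in> fingerprints n" and K: "K \<subseteq> {1..n}"
  shows "measure_pmf.prob (pmf_of_set (fingerprints n)) {z. \<forall>i\<in>K. z i = x i} = (1/2) ^ card K"
proof -
  have "fingerprints n \<inter> {z. \<forall>i\<in>K. z i = x i}
      = (\<Pi>\<^sub>E i\<in>{1..n}. if i \<in> K then {x i} else {-1, 1})"
  proof (intro equalityI subsetI)
    fix z assume z: "z \<in> (\<Pi>\<^sub>E i\<in>{1..n}. if i \<in> K then {x i} else {-1, 1})"
    have "z i = x i" if "i \<in> K" for i
      using PiE_mem[OF z, of i] that K by auto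
    moreover have "z i \<in> {-1, 1}" if "i \<in> {1..n}" for i
      using PiE_mem[OF z that] x that by (auto simp: fingerprints_def PiE_def Pi_def split: if_splits)
    moreover have "z \<in> extensional {1..n}"
      using z by (auto simp: PiE_def)
    ultimately show "z \<in> fingerprints n \<inter> {z. \<forall>i\<in>K. z i = x i}"
      by (auto simp: fingerprints_def PiE_def)
  qed (auto simp: fingerprints_def PiE_def Pi_def)
  then have "card (fingerprints n \<inter> {z. \<forall>i\<in>K. z i = x i})
      = (\<Prod>i\<in>{1..n}. if i \<in> K then 1 else 2)"
    by (auto simp: card_PiE intro!: prod.cong)
  also have "\<dots> = 2 ^ card ({1..n} - K)"
    by (simp add: prod.If_cases Diff_eq)
  also have "card ({1..n} - K) = n - card K"
    using K by (simp add: card_Diff_subset finite_subset)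
  finally have "card (fingerprints n \<inter> {z. \<forall>i\<in>K. z i = x i}) * 2 ^ card K = 2 ^ n"
    using card_mono[OF _ K] by (simp flip: power_add)
  then have "real (card (fingerprints n \<inter> {z. \<forall>i\<in>K. z i = x i})) * 2 ^ card K = 2 ^ n"
    unfolding of_nat_eq_iff[where 'a = real, symmetric] by simp
  then have "real (card (fingerprints n \<inter> {z. \<forall>i\<in>K. z i = x i})) / 2 ^ n = 1 / 2 ^ card K"
    by (subst frac_eq_eq) auto
  then show ?thesis
    by (simp add: measure_pmf_of_set card_fingerprints power_divide)
qed

section \<open>Confusable coalitions\<close>

text \<open>This event depends on the codebook alone, which separates its probability from the
  decoder's tie-breaking.\<close>

definition confusable :: "nat \<Rightarrow> nat \<Rightarrow> nat set \<Rightarrow> codebook set" where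
  "confusable n M U = {f. \<not> md_candidates n M f (averaging_attack f U) \<subseteq> U}"

text \<open>Averages, over a uniform set \<open>K\<close> of unerased positions, the probability
  that at least one of \<open>M - 2\<close> independent innocent fingerprints matches on
  \<open>K\<close>.\<close>

definition confusion_prob :: "nat \<Rightarrow> nat \<Rightarrow> real" where
  "confusion_prob n M = (\<Sum>K\<in>Pow {1..n}. 1 - (1 - (1/2) ^ card K) ^ (M - 2)) / 2 ^ n"

text \<open>Averaging two signs gives 0 where they differ and their common value elsewhere, so
  \<open>f a\<close> can stand in for the forgery.\<close>

lemma md_candidates_pair:
  assumes "a \<noteq> b" and fa: "f a \<in> fingerprints n" and fb: "f b \<in> fingerprints n"
  shows "md_candidates n M f (averaging_attack f {a, b})
      = {u \<in> {1..M}. \<forall>i\<in>agreement n (f a) (f b). f u i = f a i}"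
proof -
  have "(averaging_attack f {a, b} i \<noteq> 0 \<longrightarrow> f u i = averaging_attack f {a, b} i)
      \<longleftrightarrow> (f a i = f b i \<longrightarrow> f u i = f a i)" if i: "i \<in> {1..n}" for u i
    by (cases rule: fingerprints_cases[OF fa i]; cases rule: fingerprints_cases[OF fb i])
       (use \<open>a \<noteq> b\<close> in \<open>auto simp: averaging_attack_def\<close>)
  then show ?thesis
    by (auto simp: md_candidates_def agreement_def)
qed

text \<open>Given the pirates' fingerprints, the innocent ones are still i.i.d., and the conditional
  probability depends on the pirates only through their agreement set, which is uniform.\<close>

lemma measure_iid_confusable:
  assumes U: "U \<in> coalitions M"
  shows "measure_pmf.prob (iid_ensemble n M) (confusable n M U) = confusion_prob n M"
proof -
  from U obtain a b where ab: "a \<noteq> b" "U = {a, b}"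
    by (auto simp: coalitions_def card_2_iff)
  define W where "W = {1..M} - {a, b}"
  have M: "{1..M} = insert a (insert b W)" and W: "finite W" "a \<notin> insert b W" "b \<notin> W"
    using U ab by (auto simp: W_def coalitions_def)
  have cardW: "card W = M - 2"
    using U ab by (simp add: W_def coalitions_def card_Diff_subset)
  let ?F = "pmf_of_set (fingerprints n)"
  let ?P = "Pi_pmf W undefined (\<lambda>_. ?F)"
  \<comment> \<open>The pirates' fingerprints \<open>x\<close> and \<open>z\<close> are drawn first,
    the innocent ones last.\<close>
  have iid: "iid_ensemble n M = bind_pmf ?F (\<lambda>x. bind_pmf ?F (\<lambda>z.
      map_pmf (\<lambda>g. g(b := z, a := x)) ?P))"
    unfolding iid_ensemble_def M using W
    by (simp add: Pi_pmf_insert' bind_assoc_pmf bind_return_pmf map_pmf_def)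
  have inner: "measure_pmf.prob (map_pmf (\<lambda>g. g(b := z, a := x)) ?P) (confusable n M U)
      = 1 - (1 - (1/2) ^ card (agreement n x z)) ^ (M - 2)"
    if x: "x \<in> fingerprints n" and z: "z \<in> fingerprints n" for x z
  proof -
    let ?A = "{w. \<forall>i\<in>agreement n x z. w i = x i}"
    \<comment> \<open>Confusion fails exactly when every innocent fingerprint avoids
      \<open>?A\<close>. This is a product event, so its probability factorizes.\<close>
    have pre: "(\<lambda>g. g(b := z, a := x)) -` confusable n M U = UNIV - Pi W (\<lambda>_. - ?A)"
    proof -
      have "g(b := z, a := x) \<in> confusable n M U \<longleftrightarrow> (\<exists>u\<in>W. g u \<in> ?A)" for g
      proof -
        let ?g = "g(b := z, a := x)"
        have "md_candidates n M ?g (averaging_attack ?g U)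
            = {u \<in> {1..M}. \<forall>i\<in>agreement n x z. ?g u i = x i}"
          using md_candidates_pair[of a b ?g n M] ab x z by simp
        then have "?g \<in> confusable n M U \<longleftrightarrow> (\<exists>u\<in>W. ?g u \<in> ?A)"
          unfolding confusable_def W_def ab(2) by blast
        also have "\<dots> \<longleftrightarrow> (\<exists>u\<in>W. g u \<in> ?A)"
          by (intro bex_cong refl) (auto simp: W_def)
        finally show ?thesis .
      qed
      then show ?thesis
        by (simp add: vimage_def Pi_def set_eq_iff) blast
    qed
    have sub: "agreement n x z \<subseteq> {1..n}"
      by (auto simp: agreement_def)
    have "measure_pmf.prob ?F (- ?A) = 1 - (1/2) ^ card (agreement n x z)"
      using prob_agree_on[OF x sub] measure_pmf.prob_compl[of ?A ?F] by (simp add: Compl_eq_Diff_UNIV)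
    then have "measure_pmf.prob ?P (Pi W (\<lambda>_. - ?A)) = (1 - (1/2) ^ card (agreement n x z)) ^ (M - 2)"
      using W cardW by (simp add: measure_Pi_pmf_Pi)
    then show ?thesis
      using measure_pmf.prob_compl[of "Pi W (\<lambda>_. - ?A)" ?P] by (simp add: pre)
  qed
  show ?thesis
    unfolding iid
  \<comment> \<open>For each fixed \<open>x\<close> the average over \<open>z\<close> already has
    the claimed value.\<close>
  proof (rule measure_bind_pmf_const)
    fix x assume "x \<in> set_pmf ?F"
    then have x: "x \<in> fingerprints n"
      by simp
    have "measure_pmf.prob (bind_pmf ?F (\<lambda>z. map_pmf (\<lambda>g. g(b := z, a := x)) ?P)) (confusable n M U)
        = (\<Sum>z\<in>fingerprints n. 1 - (1 - (1/2) ^ card (agreement n x z)) ^ (M - 2)) / 2 ^ n"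
      unfolding measure_bind_pmf
      by (subst integral_pmf_of_set)
         (auto simp: card_fingerprints inner[OF x] simp del: measure_map_pmf intro!: sum.cong)
    also have "\<dots> = confusion_prob n M"
      unfolding confusion_prob_def
      by (subst sum.reindex_bij_betw[OF bij_betw_agreement[OF x], symmetric]) simp
    finally show "measure_pmf.prob (bind_pmf ?F (\<lambda>z. map_pmf (\<lambda>g. g(b := z, a := x)) ?P))
        (confusable n M U) = confusion_prob n M" .
  qed
qed

text \<open>Makes the candidate set nonempty, so that the decoder's \<open>pmf_of_set\<close> is a
  genuine uniform choice, and lets the pirates be counted as exactly two of the candidates.\<close>

lemma coalition_subset_candidates:
  assumes U: "U \<in> coalitions M" and f: "f \<in> set_pmf (iid_ensemble n M)"
  shows "U \<subseteq> md_candidates n M f (averaging_attack f U)"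
proof -
  from U obtain a b where ab: "a \<noteq> b" "U = {a, b}" "{a, b} \<subseteq> {1..M}"
    by (auto simp: coalitions_def card_2_iff)
  have "f u \<in> fingerprints n" if "u \<in> {1..M}" for u
    using f that unfolding iid_ensemble_def
    by (auto simp: set_Pi_pmf PiE_dflt_def)
  then have "f a \<in> fingerprints n" "f b \<in> fingerprints n"
    using ab by auto
  from md_candidates_pair[OF ab(1) this] show ?thesis
    using ab by (auto simp: agreement_def)
qed

text \<open>
  The factor \<open>1/3\<close> comes from one innocent candidate competing with the two pirates.
\<close>

lemma md_decoder_error_bounds:
  assumes U: "U \<in> coalitions M" and f: "f \<in> set_pmf (iid_ensemble n M)"
  defines "e \<equiv> measure_pmf.prob (md_decoder n M f (averaging_attack f U)) (- U)"
  shows "e \<le> indicator (confusable n M U) f" "1/3 * indicator (confusable n M U) f \<le> e"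
proof -
  let ?C = "md_candidates n M f (averaging_attack f U)"
  have sub: "U \<subseteq> ?C" and fin: "finite ?C" and two: "card U = 2"
    using coalition_subset_candidates[OF U f] U by (auto simp: md_candidates_def coalitions_def)
  then have ne: "?C \<noteq> {}"
    by auto
  have e: "e = card (?C - U) / card ?C"
    unfolding e_def md_decoder_def using measure_pmf_of_set[OF ne fin] by (simp add: Diff_eq)
  have c: "card ?C = card (?C - U) + 2"
    using sub fin two by (metis card_Diff_subset card_mono finite_subset le_add_diff_inverse2)
  show "e \<le> indicator (confusable n M U) f"
  proof (cases "f \<in> confusable n M U")
    case False
    then have "?C - U = {}"
      by (auto simp: confusable_def)
    with e show ?thesis
      by simp
  qed (simp add: e_def)
  show "1/3 * indicator (confusable n M U) f \<le> e"
  proof (cases "f \<in> confusable n M U")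
    case True
    then have "card (?C - U) \<ge> 1"
      using fin by (auto simp: confusable_def Suc_le_eq card_gt_0_iff)
    moreover have "e = card (?C - U) / (card (?C - U) + 2)"
      unfolding e c by simp
    ultimately show ?thesis
      using True by (simp add: le_divide_eq)
  qed (simp add: e_def)
qed

lemma misid_prob_iid_bounds:
  assumes "M \<ge> 2"
  shows "misid_prob iid_ensemble n M \<le> confusion_prob n M"
    and "1/3 * confusion_prob n M \<le> misid_prob iid_ensemble n M"
proof -
  let ?X = "{(U, g). g \<notin> U} :: (nat set \<times> nat) set"
  let ?D = "\<lambda>U f. map_pmf (Pair U) (md_decoder n M f (averaging_attack f U))"
  have fin: "finite (coalitions M)"
    by (rule finite_subset[of _ "Pow {1..M}"]) (auto simp: coalitions_def)
  have "{1, 2} \<in> coalitions M"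
    using assms by (auto simp: coalitions_def)
  then have set: "set_pmf (pmf_of_set (coalitions M)) = coalitions M"
    using fin by (intro set_pmf_of_set) auto
  \<comment> \<open>Codebook and coalition are independent, so the coalition may be drawn first and
    held fixed.\<close>
  have misid: "misid_prob iid_ensemble n M = measure_pmf.prob
      (bind_pmf (pmf_of_set (coalitions M)) (\<lambda>U. bind_pmf (iid_ensemble n M) (?D U))) ?X"
    unfolding misid_prob_def by (subst bind_commute_pmf) (simp add: map_pmf_def)
  have D: "measure_pmf.prob (?D U f) ?X
      = measure_pmf.prob (md_decoder n M f (averaging_attack f U)) (- U)" for U f
    by (simp add: vimage_def Compl_eq)
  have up: "measure_pmf.prob (bind_pmf (iid_ensemble n M) (?D U)) ?X \<le> confusion_prob n M"
    and lo: "1/3 * confusion_prob n M \<le> measure_pmf.prob (bind_pmf (iid_ensemble n M) (?D U)) ?X"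
    if U: "U \<in> coalitions M" for U
    using measure_bind_pmf_le[of "iid_ensemble n M" "?D U" ?X 1 "confusable n M U"]
      measure_bind_pmf_ge[of "iid_ensemble n M" "1/3" "confusable n M U" "?D U" ?X]
      md_decoder_error_bounds[OF U]
    unfolding measure_iid_confusable[OF U] D by auto
  show "misid_prob iid_ensemble n M \<le> confusion_prob n M"
    unfolding misid
    using measure_bind_pmf_le[of "pmf_of_set (coalitions M)" _ ?X "confusion_prob n M" UNIV] up set
    by simp
  show "1/3 * confusion_prob n M \<le> misid_prob iid_ensemble n M"
    unfolding misid
    using measure_bind_pmf_ge[of "pmf_of_set (coalitions M)" "1/3 * confusion_prob n M" UNIV _ ?X] lo set
    by simp
qed

section \<open>Asymptotics of the confusion probability\<close>

text \<open>Expanding the product of \<open>1 + s\<close> over \<open>A\<close> gives one term per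
  subset. Up to normalization this is the generating function of the size of a uniform
  subset.\<close>

lemma sum_Pow_power_card:
  fixes s :: "'b :: comm_semiring_1"
  assumes "finite A"
  shows "(\<Sum>K\<in>Pow A. s ^ card K) = (1 + s) ^ card A"
  using prod_add[OF assms, of "\<lambda>_. s" "\<lambda>_. 1"] by (simp add: add.commute)

text \<open>
  Interpolating between the trivial bound \<open>1\<close> and the union bound \<open>M q\<close> by the exponent \<open>l\<close> amounts to
  a Chernoff bound for the number of unerased positions.
\<close>

lemma confusion_prob_le:
  assumes l: "0 \<le> l" "l \<le> 1" and M: "M \<ge> 2"
  shows "confusion_prob n M \<le> real M powr l * ((1 + 2 powr (-l)) / 2) ^ n"
proof -
  have "1 - (1 - (1/2) ^ k) ^ (M - 2) \<le> real M powr l * (2 powr (-l)) ^ k" for k :: nat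
  proof -
    define q :: real where "q = (1/2) ^ k"
    have q: "0 < q" "q \<le> 1"
      by (auto simp: q_def power_le_one)
    \<comment> \<open>Bernoulli's inequality serves as the union bound over the innocent
      users.\<close>
    have "1 - real (M - 2) * q \<le> (1 - q) ^ (M - 2)"
      using Bernoulli_inequality[of "- q" "M - 2"] q by (simp add: algebra_simps)
    moreover have "real (M - 2) * q \<le> M * q"
      using q by (intro mult_right_mono) auto
    moreover have "0 \<le> (1 - q) ^ (M - 2)"
      using q by simp
    ultimately have b: "1 - (1 - q) ^ (M - 2) \<le> min 1 (M * q)"
      by linarith
    \<comment> \<open>A number in (0, 1] does not decrease under a power \<open>l\<close> with
      \<open>l \<le> 1\<close>; a number above 1 stays at least 1 because
      \<open>0 \<le> l\<close>.\<close>
    have "min 1 (M * q) \<le> (M * q) powr l"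
    proof (cases "M * q \<le> 1")
      case True
      then show ?thesis
        using powr_mono'[OF l(2), of "M * q"] q M by simp
    next
      case False
      then show ?thesis
        using ge_one_powr_ge_zero[of "M * q" l] l by simp
    qed
    also have "\<dots> = real M powr l * q powr l"
      using q by (simp add: powr_mult)
    finally have *: "min 1 (M * q) \<le> real M powr l * q powr l" .
    have "q = 2 powr (- real k)"
      by (simp add: q_def powr_minus_divide powr_realpow power_one_over)
    then have "q powr l = (2 powr (-l)) ^ k"
      by (simp add: powr_powr powr_power mult.commute)
    then show ?thesis
      using order_trans[OF b *] by (simp only: q_def)
  qed
  then have "(\<Sum>K\<in>Pow {1..n}. 1 - (1 - (1/2) ^ card K) ^ (M - 2))
      \<le> (\<Sum>K\<in>Pow {1..n}. real M powr l * (2 powr (-l)) ^ card K)"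
    by (intro sum_mono)
  also have "\<dots> = real M powr l * (1 + 2 powr (-l)) ^ n"
    by (simp add: sum_Pow_power_card flip: sum_distrib_left)
  finally show ?thesis
    by (simp add: confusion_prob_def power_divide divide_right_mono)
qed

text \<open>The threshold 1/2 arises here: at \<open>l = 0\<close> the exponent is 0 with slope
  \<open>R - 1/2\<close>, because \<open>2 powr (-l)\<close> has slope \<open>- ln 2\<close> there,
  which the factor 1/2 and the base-2 logarithm turn into -1/2. So a small positive \<open>l\<close>
  makes it negative.\<close>

lemma exists_tilt:
  fixes R :: real
  assumes "R < 1/2"
  shows "\<exists>l. 0 < l \<and> l \<le> 1 \<and> l * R + log 2 ((1 + 2 powr (-l)) / 2) < 0"
proof -
  define g where "g = (\<lambda>l. l * R + log 2 ((1 + 2 powr (-l)) / 2))"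
  have "(g has_real_derivative R - 1/2) (at 0)"
    unfolding g_def by (auto intro!: derivative_eq_intros simp: log_def field_simps)
  from DERIV_neg_dec_right[OF this] assms obtain d
    where d: "d > 0" "\<And>h. h > 0 \<Longrightarrow> h < d \<Longrightarrow> g h < g 0"
    by auto
  have "g 0 = 0"
    by (simp add: g_def)
  then show ?thesis
    using d(2)[of "min 1 (d/2)"] d(1) unfolding g_def by (intro exI[of _ "min 1 (d/2)"]) auto
qed

text \<open>Complementation injects the large subsets into the small ones; subsets of exactly half
  size count as both.\<close>

lemma card_le_half_subsets:
  fixes A :: "'a set"
  assumes "finite A"
  shows "2 ^ card A \<le> 2 * card {K \<in> Pow A. 2 * card K \<le> card A}"
proof -
  let ?L = "{K \<in> Pow A. 2 * card K \<le> card A}" and ?H = "{K \<in> Pow A. 2 * card K \<ge> card A}"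
  have fin: "finite ?L" "finite ?H"
    using assms by auto
  have cA: "card (A - K) = card A - card K" "card K \<le> card A" if "K \<subseteq> A" for K
    using assms that by (auto simp: card_Diff_subset finite_subset card_mono)
  have "card ?H \<le> card ?L"
  proof (rule card_inj_on_le[OF _ _ fin(1)])
    show "inj_on (\<lambda>K. A - K) ?H"
      by (rule inj_onI) blast
    show "(\<lambda>K. A - K) ` ?H \<subseteq> ?L"
      using cA by auto
  qed
  moreover have "card (Pow A) \<le> card ?L + card ?H"
    using card_mono[of "?L \<union> ?H" "Pow A"] card_Un_le[of ?L ?H] fin by force
  ultimately show ?thesis
    using assms by (simp add: card_Pow)
qed

text \<open>The hypothesis says that with \<open>n / 2\<close> unerased positions the expected
  number of innocent candidates is at least 1. Then at least half of the sets \<open>K\<close>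
  contribute a term of at least \<open>1 - 1/e\<close>, hence at least 1/2.\<close>

lemma confusion_prob_ge:
  assumes "1 \<le> 2 powr (- real n / 2) * real (M - 2)"
  shows "1/4 \<le> confusion_prob n M"
proof -
  let ?L = "{K \<in> Pow {1..n}. 2 * card K \<le> n}"
  have term_ge: "(1/2 :: real) \<le> 1 - (1 - (1/2) ^ k) ^ (M - 2)" if k: "2 * k \<le> n" for k
  proof -
    define q :: real where "q = (1/2) ^ k"
    have q: "0 < q" "q \<le> 1"
      by (auto simp: q_def power_le_one)
    have "2 powr (- real n / 2) \<le> 2 powr (- real k)"
      using k by (intro powr_mono) auto
    also have "\<dots> = q"
      by (simp add: q_def powr_minus_divide powr_realpow power_one_over)
    finally have "1 \<le> q * real (M - 2)"
      using assms mult_right_mono[of "2 powr (- real n / 2)" q "real (M - 2)"] by linarith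
    moreover have "(1 - q) ^ (M - 2) \<le> exp (- q) ^ (M - 2)"
      using q exp_ge_add_one_self[of "- q"] by (intro power_mono) auto
    moreover have "exp (- q) ^ (M - 2) = exp (- (q * real (M - 2)))"
      using exp_of_nat_mult[of "M - 2" "- q"] by (simp add: mult.commute)
    ultimately have "(1 - q) ^ (M - 2) \<le> exp (- 1)"
      by (smt (verit) exp_le_cancel_iff)
    also have "\<dots> \<le> 1/2"
      using exp_ge_add_one_self[of 1] by (simp add: exp_minus field_simps)
    finally show ?thesis
      by (simp add: q_def)
  qed
  have "2 ^ n \<le> 2 * card ?L"
    using card_le_half_subsets[of "{1..n}"] by simp
  then have "2 ^ n \<le> 2 * real (card ?L)"
    unfolding of_nat_le_iff[where 'a = real, symmetric] by simp
  then have "2 ^ n / 4 \<le> (\<Sum>K\<in>?L. 1/2 :: real)"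
    by simp
  also have "\<dots> \<le> (\<Sum>K\<in>?L. 1 - (1 - (1/2) ^ card K) ^ (M - 2))"
    using term_ge by (intro sum_mono) auto
  also have "\<dots> \<le> (\<Sum>K\<in>Pow {1..n}. 1 - (1 - (1/2) ^ card K) ^ (M - 2))"
    by (intro sum_mono2) (auto simp: power_le_one)
  finally show ?thesis
    by (simp add: confusion_prob_def field_simps)
qed

section \<open>Rates and the two halves of the capacity statement\<close>

lemma num_users_bounds:
  "real (num_users R n) \<le> 2 powr (real n * R)" "2 powr (real n * R) < real (num_users R n) + 1"
proof -
  have "real (num_users R n) = of_int \<lfloor>2 powr (real n * R)\<rfloor>"
    by (simp add: num_users_def)
  then show "real (num_users R n) \<le> 2 powr (real n * R)" "2 powr (real n * R) < real (num_users R n) + 1"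
    by linarith+
qed

lemma eventually_two_powr_ge:
  fixes a :: real
  assumes "0 < a"
  shows "\<forall>\<^sub>F n in sequentially. B \<le> 2 powr (real n * a)"
proof -
  have "filterlim (\<lambda>n. 2 powr (real n * a)) at_top sequentially"
    using assms by real_asymp
  then show ?thesis
    by (auto simp: filterlim_at_top)
qed

lemma eventually_num_users_ge:
  assumes "0 < R"
  shows "\<forall>\<^sub>F n in sequentially. num_users R n \<ge> 2"
  \<comment> \<open>The value 3 absorbs the loss of less than 1 in rounding down.\<close>
  using eventually_two_powr_ge[OF assms, of 3]
proof eventually_elim
  case (elim n)
  then show ?case
    using num_users_bounds(2)[of n R] by linarith
qed

lemma misid_prob_iid_achievability:
  assumes "0 < R" "R < 1/2"
  shows "\<exists>c>0. \<forall>\<^sub>F n in sequentially. misid_prob iid_ensemble n (num_users R n) \<le> 2 powr (- c * real n)"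
proof -
  from exists_tilt[OF assms(2)] obtain l
    where l: "0 < l" "l \<le> 1" "l * R + log 2 ((1 + 2 powr (-l)) / 2) < 0"
    by blast
  define t where "t = log 2 ((1 + 2 powr (-l)) / 2)"
  have t: "(1 + 2 powr (-l)) / 2 = 2 powr t"
    unfolding t_def by (subst powr_log_cancel) (auto intro!: add_pos_pos)
  have "\<forall>\<^sub>F n in sequentially. misid_prob iid_ensemble n (num_users R n) \<le> 2 powr ((l * R + t) * real n)"
    using eventually_num_users_ge[OF assms(1)]
  proof eventually_elim
    case (elim n)
    let ?M = "num_users R n"
    have "misid_prob iid_ensemble n ?M \<le> real ?M powr l * (2 powr t) ^ n"
      using misid_prob_iid_bounds(1)[OF elim, of n] confusion_prob_le[of l ?M n] l elim t by simp
    also have "\<dots> \<le> (2 powr (real n * R)) powr l * (2 powr t) ^ n"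
      using num_users_bounds(1)[of R n] l by (intro mult_right_mono powr_mono2) auto
    also have "\<dots> = 2 powr ((l * R + t) * real n)"
      by (simp add: powr_powr powr_power powr_add algebra_simps)
    finally show ?case .
  qed
  then show ?thesis
    using l(3) unfolding t_def[symmetric]
    by (intro exI[of _ "- (l * R + t)"]) (simp only: neg_0_less_iff_less minus_minus simp_thms)
qed

text \<open>The constant 1/13 lies just below \<open>1/3 * 1/4\<close>, since the inequality is
  strict.\<close>

lemma misid_prob_iid_converse:
  assumes "1/2 < R"
  shows "\<forall>\<^sub>F n in sequentially. 1/13 < misid_prob iid_ensemble n (num_users R n)"
proof -
  have pos: "0 < R" "0 < R - 1/2"
    using assms by auto
  show ?thesis
    \<comment> \<open>Rounding down and removing the two pirates costs at most 3, and the scaling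
      factor is at most 1, so 4 leaves the required 1.\<close>
    using eventually_num_users_ge[OF pos(1)] eventually_two_powr_ge[OF pos(2), of 4]
  proof eventually_elim
    case (elim n)
    let ?M = "num_users R n"
    have "2 powr (- real n / 2) * 2 powr (real n * R) = 2 powr (real n * (R - 1/2))"
      by (simp add: algebra_simps flip: powr_add)
    then have "4 \<le> 2 powr (- real n / 2) * 2 powr (real n * R)"
      using elim by simp
    also have "\<dots> \<le> 2 powr (- real n / 2) * (real (?M - 2) + 3)"
      using num_users_bounds(2)[of n R] elim(1) by (intro mult_left_mono) auto
    also have "\<dots> \<le> 2 powr (- real n / 2) * real (?M - 2) + 3"
      using powr_mono[of "- real n / 2" 0 2] by (simp add: algebra_simps)
    finally have "1 \<le> 2 powr (- real n / 2) * real (?M - 2)"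
      by linarith
    then have "1/4 \<le> confusion_prob n ?M"
      by (rule confusion_prob_ge)
    then show ?case
      using misid_prob_iid_bounds(2)[OF elim(1), of n] by simp
  qed
qed

theorem theorem1:
  "md_capacity iid_ensemble (1/2)"
  unfolding md_capacity_def
proof (intro conjI allI impI)
  fix R :: real
  show "\<exists>c>0. \<forall>\<^sub>F n in sequentially. misid_prob iid_ensemble n (num_users R n) \<le> 2 powr (- c * real n)"
    if "0 < R \<and> R < 1/2"
    using misid_prob_iid_achievability that by blast
  show "\<exists>\<delta>>0. \<forall>\<^sub>F n in sequentially. \<delta> < misid_prob iid_ensemble n (num_users R n)"
    if "1/2 < R \<and> 0 < R"
    using misid_prob_iid_converse that by (intro exI[of _ "1/13"]) auto
qed simp

end
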